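(* Let $A=\{a_1,a_2\}$ and $E=\{e_1,e_2\}$ be two alphabets. Then, as formal power series in $z$, $$\sum_{n=0}^{\infty} S_n(A)\,S_{2n}(E)\,z^n=\frac{1+e_1e_2(a_1+a_2)z-e_1e_2a_1a_2\left((e_1+e_2)^2-e_1e_2\right)z^2}{\left(\sum_{n=0}^{\infty}S_n(-A)e_1^{2n}z^n\right)\left(\sum_{n=0}^{\infty}S_n(-A)e_2^{2n}z^n\right)}.$$
   Context: Here $a_1,a_2,e_1,e_2$ are commuting variables (an alphabet is a set of variables), and identities are between formal power series in $z$ with coefficients in $\mathbb{Z}[a_1,a_2,e_1,e_2]$; the denominator has constant term $1$, so it is invertible. For an alphabet $X=\{x_1,x_2\}$, $S_n(X)$ is defined by $\sum_{n\ge 0}S_n(X)z^n=\frac{1}{(1-x_1z)(1-x_2z)}$, equivalently $S_n(X)=\frac{x_1^{n+1}-x_2^{n+1}}{x_1-x_2}$ for $n\ge 0$, and $S_n(X)=0$ for $n<0$. The quantities $S_n(-A)$ are defined by $\sum_{n\ge 0}S_n(-A)z^n=(1-a_1z)(1-a_2z)$. *)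

theory Defs
  imports "HOL-Library.Poly_Mapping" "HOL-Computational_Algebra.Formal_Power_Series"
begin

datatype variable = Var_a1 | Var_a2 | Var_e1 | Var_e2

text \<open>
  Monomials are exponent vectors \<^typ>\<open>variable \<Rightarrow>\<^sub>0 nat\<close>, and polynomials are finitely
  supported integer-valued functions on monomials; the product on the outer level is the convolution
  product, so this type is the ring of polynomials over the integers in the four variables.
\<close>

type_synonym polynomial = "(variable \<Rightarrow>\<^sub>0 nat) \<Rightarrow>\<^sub>0 int"

definition indet :: "variable \<Rightarrow> polynomial" where
  "indet v = Poly_Mapping.single (Poly_Mapping.single v 1) 1"

abbreviation a1 :: polynomial where "a1 \<equiv> indet Var_a1"
abbreviation a2 :: polynomial where "a2 \<equiv> indet Var_a2"
abbreviation e1 :: polynomial where "e1 \<equiv> indet Var_e1"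
abbreviation e2 :: polynomial where "e2 \<equiv> indet Var_e2"

text \<open>
  The library's \<^const>\<open>inverse\<close> and division on \<^typ>\<open>'a fps\<close> need an inverse operation on
  the coefficients. For constant term 1 the following reciprocal is available over every ring; it is
  meaningful only in that case.
\<close>

definition fps_recip :: "'a::comm_ring_1 fps \<Rightarrow> 'a fps" where
  "fps_recip f = fps_right_inverse f 1"

definition fps_quot :: "'a::comm_ring_1 fps \<Rightarrow> 'a fps \<Rightarrow> 'a fps" where
  "fps_quot f g = f * fps_recip g"

lemma fps_mult_recip:
  assumes "fps_nth f 0 = 1"
  shows "f * fps_recip f = 1"
  unfolding fps_recip_def by (rule fps_right_inverse) (simp add: assms)

lemma fps_quot_mult:
  assumes "fps_nth g 0 = 1"
  shows "fps_quot f g * g = f"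
  using fps_mult_recip[OF assms] by (simp add: fps_quot_def mult.commute mult.left_commute)

text \<open>
  \<open>S_neg X n\<close> stands for $S_n(-X)$. An alphabet is a finite set of ring elements.
\<close>

definition S :: "'a::comm_ring_1 set \<Rightarrow> int \<Rightarrow> 'a" where
  "S X n = (if n < 0 then 0
            else fps_nth (fps_quot 1 (\<Prod>x\<in>X. 1 - fps_const x * fps_X)) (nat n))"

definition S_neg :: "'a::comm_ring_1 set \<Rightarrow> nat \<Rightarrow> 'a" where
  "S_neg X n = fps_nth (\<Prod>x\<in>X. 1 - fps_const x * fps_X) n"

end

theory Submission
  imports Defs
begin

text \<open>
  Both \<open>S A n\<close> and \<open>S E (2 * n)\<close> satisfy a linear recurrence of order two, the latter with
  characteristic roots \<open>e1\<^sup>2\<close> and \<open>e2\<^sup>2\<close>. Their product therefore satisfies the recurrence of order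
  four whose characteristic roots are the products of the roots, which is the one encoded by
  the denominator; the numerator is determined by the four initial coefficients. The argument
  involves no division by \<open>e1 - e2\<close> and is valid in every commutative ring.
\<close>

text \<open>Alphabets are sets, so \<open>{a1, a2}\<close> and \<open>{e1, e2}\<close> have two
  elements only because distinct variables give distinct polynomials.\<close>

lemma indet_eq_iff: "indet v = indet w \<longleftrightarrow> v = w"
proof
  assume "indet v = indet w"
  then have "Poly_Mapping.lookup (indet v) (Poly_Mapping.single v 1)
      = Poly_Mapping.lookup (indet w) (Poly_Mapping.single v 1)"
    by simp
  then have "Poly_Mapping.single w (1::nat) = Poly_Mapping.single v 1"
    by (auto simp: indet_def lookup_single when_def split: if_splits)
  then have "Poly_Mapping.lookup (Poly_Mapping.single w (1::nat)) w
      = Poly_Mapping.lookup (Poly_Mapping.single v 1) w"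
    by simp
  then show "v = w"
    by (auto simp: lookup_single when_def split: if_splits)
qed simp

lemma fps_quot_unique:
  assumes "fps_nth g 0 = 1" and "h * g = f"
  shows "fps_quot f g = h"
  using fps_mult_recip[OF assms(1)] assms(2) by (auto simp: fps_quot_def mult.assoc)

text \<open>Serves every coefficient comparison below: with an inverse series as \<open>F\<close> it
  yields a recurrence, and used twice it expands a product with both denominator factors.\<close>

lemma fps_mult_quadratic_nth:
  fixes F :: "'a::comm_ring_1 fps" and c d :: 'a
  defines "G \<equiv> F * (1 - fps_const c * fps_X + fps_const d * fps_X\<^sup>2)"
  shows "fps_nth G 0 = fps_nth F 0"
    and "fps_nth G (Suc 0) = fps_nth F (Suc 0) - c * fps_nth F 0"
    and "fps_nth G (Suc (Suc n)) = fps_nth F (Suc (Suc n)) - c * fps_nth F (Suc n) + d * fps_nth F n"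
proof -
  have G: "G = F - fps_const c * (F * fps_X) + fps_const d * (F * fps_X * fps_X)"
    by (simp add: G_def power2_eq_square algebra_simps)
  show "fps_nth G 0 = fps_nth F 0"
    and "fps_nth G (Suc 0) = fps_nth F (Suc 0) - c * fps_nth F 0"
    and "fps_nth G (Suc (Suc n)) = fps_nth F (Suc (Suc n)) - c * fps_nth F (Suc n) + d * fps_nth F n"
    by (simp_all add: G)
qed

text \<open>If \<open>x = y\<close>, the set would be a singleton and the product a single linear
  factor.\<close>

lemma prod_linear_factors_pair:
  fixes x y :: "'a::comm_ring_1"
  assumes "x \<noteq> y"
  shows "(\<Prod>t\<in>{x, y}. 1 - fps_const t * fps_X)
    = 1 - fps_const (x + y) * fps_X + fps_const (x * y) * fps_X\<^sup>2"
  using assms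
  by (simp add: power2_eq_square algebra_simps flip: fps_const_add fps_const_mult)

lemma S_pair_rec:
  fixes x y :: "'a::comm_ring_1"
  assumes "x \<noteq> y"
  shows "S {x, y} 0 = 1"
    and "S {x, y} 1 = x + y"
    and "S {x, y} (int n + 2) = (x + y) * S {x, y} (int n + 1) - x * y * S {x, y} (int n)"
proof -
  define P where "P = 1 - fps_const (x + y) * fps_X + fps_const (x * y) * fps_X\<^sup>2"
  have S: "S {x, y} (int k) = fps_nth (fps_quot 1 P) k" for k
    by (simp only: S_def P_def prod_linear_factors_pair[OF assms]) simp
  have "fps_quot 1 P * P = 1"
    by (rule fps_quot_mult) (simp add: P_def)
  then have *: "fps_nth (fps_quot 1 P * P) k = fps_nth 1 k" for k
    by simp
  note nth = fps_mult_quadratic_nth[of "fps_quot 1 P" "x + y" "x * y", folded P_def]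
  show 0: "S {x, y} 0 = 1"
    using *[of 0] S[of 0] nth(1) by simp
  show "S {x, y} 1 = x + y"
    using *[of "Suc 0"] S[of "Suc 0"] S[of 0] 0 nth(2) by simp
  have "int n + 2 = int (Suc (Suc n))" "int n + 1 = int (Suc n)"
    by simp_all
  then show "S {x, y} (int n + 2) = (x + y) * S {x, y} (int n + 1) - x * y * S {x, y} (int n)"
    using *[of "Suc (Suc n)"] nth(3)[of n] by (simp only: S) (simp add: algebra_simps)
qed

lemma S_pair_even_rec:
  fixes x y :: "'a::comm_ring_1"
  assumes "x \<noteq> y"
  shows "S {x, y} (2 * int n + 4)
    = (x\<^sup>2 + y\<^sup>2) * S {x, y} (2 * int n + 2) - x\<^sup>2 * y\<^sup>2 * S {x, y} (2 * int n)"
proof -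
  define s where "s k = S {x, y} (2 * int n + int k)" for k
  have rec: "s (k + 2) = (x + y) * s (k + 1) - x * y * s k" for k
    using S_pair_rec(3)[OF assms, of "2 * n + k"] by (simp add: s_def algebra_simps)
  \<comment> \<open>The odd-index term \<open>s 1\<close> must be eliminated. It enters
    \<open>s 4\<close> only with the factor \<open>x + y\<close>, so this relation removes it
    without division.\<close>
  have s2: "(x + y) * s 1 = s 2 + x * y * s 0"
    using rec[of 0] by (simp add: numeral_2_eq_2)
  have "s 4 = (x + y) * s 3 - x * y * s 2" and s3: "s 3 = (x + y) * s 2 - x * y * s 1"
    using rec[of 2] rec[of 1] by (simp_all add: eval_nat_numeral)
  then have "s 4 = (x + y)\<^sup>2 * s 2 - x * y * ((x + y) * s 1) - x * y * s 2"
    by (simp add: s3 power2_eq_square algebra_simps)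
  also have "\<dots> = (x\<^sup>2 + y\<^sup>2) * s 2 - x\<^sup>2 * y\<^sup>2 * s 0"
    unfolding s2 by (simp add: power2_eq_square algebra_simps)
  finally show ?thesis
    by (simp add: s_def)
qed

text \<open>The weight \<open>c ^ (2 * n)\<close> amounts to replacing z by c^2 z in (1 - x z)(1 - y
  z).\<close>

lemma S_neg_pair_scaled:
  fixes x y c :: "'a::comm_ring_1"
  assumes "x \<noteq> y"
  shows "Abs_fps (\<lambda>n. S_neg {x, y} n * c ^ (2 * n))
    = 1 - fps_const ((x + y) * c\<^sup>2) * fps_X + fps_const (x * y * c ^ 4) * fps_X\<^sup>2"
    (is "?L = ?R")
proof (rule fps_ext)
  fix n
  \<comment> \<open>The factor 1 gives the shape of \<open>fps_mult_quadratic_nth\<close> with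
    \<open>F = 1\<close>.\<close>
  have S_neg: "S_neg {x, y} n
      = fps_nth (1 * (1 - fps_const (x + y) * fps_X + fps_const (x * y) * fps_X\<^sup>2)) n"
    by (simp only: S_neg_def prod_linear_factors_pair[OF assms] mult_1_left)
  have R: "fps_nth ?R n = fps_nth (1 * ?R) n"
    by simp
  consider "n = 0" | "n = Suc 0" | m where "n = Suc (Suc m)"
    by (metis not0_implies_Suc)
  then show "fps_nth ?L n = fps_nth ?R n"
  proof cases
    case 3
    then show ?thesis
      unfolding R fps_nth_Abs_fps S_neg by (cases m) (simp_all only: fps_mult_quadratic_nth, simp_all)
  qed (unfold R fps_nth_Abs_fps S_neg, simp_all only: fps_mult_quadratic_nth, simp_all add: power2_eq_square algebra_simps)
qed

lemma S_product_generating_function: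
  fixes x1 x2 y1 y2 :: "'a::comm_ring_1"
  assumes x: "x1 \<noteq> x2" and y: "y1 \<noteq> y2"
  shows "Abs_fps (\<lambda>n. S {x1, x2} (int n) * S {y1, y2} (2 * int n)) =
    fps_quot
      (1 + fps_const (y1 * y2 * (x1 + x2)) * fps_X
         - fps_const (y1 * y2 * x1 * x2 * ((y1 + y2)\<^sup>2 - y1 * y2)) * fps_X\<^sup>2)
      (Abs_fps (\<lambda>n. S_neg {x1, x2} n * y1 ^ (2 * n)) *
       Abs_fps (\<lambda>n. S_neg {x1, x2} n * y2 ^ (2 * n)))"
    (is "?F = fps_quot ?N (?D1 * ?D2)")
proof (rule fps_quot_unique[symmetric])
  define f where "f n = S {x1, x2} (int n)" for n
  define g where "g n = S {y1, y2} (2 * int n)" for n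
  have f0: "f 0 = 1" and f1: "f (Suc 0) = x1 + x2"
    using S_pair_rec(1,2)[OF x] by (simp_all add: f_def)
  have f2: "f (Suc (Suc n)) = (x1 + x2) * f (Suc n) - x1 * x2 * f n" for n
    using S_pair_rec(3)[OF x, of n] by (simp add: f_def add.commute)
  have g0: "g 0 = 1" and g1: "g (Suc 0) = (y1 + y2)\<^sup>2 - y1 * y2"
    using S_pair_rec(1,2)[OF y] S_pair_rec(3)[OF y, of 0] by (simp_all add: g_def power2_eq_square)
  have g2: "g (Suc (Suc n)) = (y1\<^sup>2 + y2\<^sup>2) * g (Suc n) - y1\<^sup>2 * y2\<^sup>2 * g n" for n
    using S_pair_even_rec[OF y, of n] by (simp add: g_def algebra_simps)
  have D: "?D1 = 1 - fps_const ((x1 + x2) * y1\<^sup>2) * fps_X + fps_const (x1 * x2 * y1 ^ 4) * fps_X\<^sup>2"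
    "?D2 = 1 - fps_const ((x1 + x2) * y2\<^sup>2) * fps_X + fps_const (x1 * x2 * y2 ^ 4) * fps_X\<^sup>2"
    by (simp_all only: S_neg_pair_scaled[OF x])
  show "fps_nth (?D1 * ?D2) 0 = 1"
    by (simp add: D)
  have nth: "fps_nth ?F n = f n * g n" for n
    by (simp add: f_def g_def)
  \<comment> \<open>The numerator is put into the same quadratic shape; its signs require negated
    constants.\<close>
  have N: "?N = 1 * (1 - fps_const (- (y1 * y2 * (x1 + x2))) * fps_X
      + fps_const (- (y1 * y2 * x1 * x2 * ((y1 + y2)\<^sup>2 - y1 * y2))) * fps_X\<^sup>2)"
    by (simp flip: fps_const_neg)
  have "?F * ?D1 * ?D2 = ?N"
  proof (rule fps_ext)
    fix n
    \<comment> \<open>The order-four recurrence covers indices from 4 on. Index 3 is computed from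
      the initial values like 0, 1 and 2, and its coefficient cancels to 0.\<close>
    consider "n = 0" | "n = Suc 0" | "n = Suc (Suc 0)" | "n = Suc (Suc (Suc 0))" | m where "n = Suc (Suc (Suc (Suc m)))"
      by (metis not0_implies_Suc)
    then show "fps_nth (?F * ?D1 * ?D2) n = fps_nth ?N n"
    proof cases
      case 5
      \<comment> \<open>Rewriting with \<open>f2\<close> and \<open>g2\<close> leaves only
        \<open>f\<close> and \<open>g\<close> at \<open>m\<close> and \<open>Suc m\<close>; the
        resulting polynomial in these values cancels identically.\<close>
      have "fps_nth (?F * ?D1 * ?D2) n = 0"
        unfolding D 5 fps_mult_quadratic_nth nth f2 g2 by (simp add: eval_nat_numeral algebra_simps)
      moreover have "fps_nth ?N n = 0"
        unfolding N 5 fps_mult_quadratic_nth by simp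
      ultimately show ?thesis by simp
    qed (unfold N D, simp_all only: fps_mult_quadratic_nth nth f2 g2 f1 g1 f0 g0, simp_all add: eval_nat_numeral algebra_simps)
  qed
  then show "?F * (?D1 * ?D2) = ?N"
    by (simp only: mult.assoc)
qed

theorem theorem2:
  shows "Abs_fps (\<lambda>n. S {a1, a2} (int n) * S {e1, e2} (2 * int n)) =
    fps_quot
      (1 + fps_const (e1 * e2 * (a1 + a2)) * fps_X
         - fps_const (e1 * e2 * a1 * a2 * ((e1 + e2)^2 - e1 * e2)) * fps_X^2)
      (Abs_fps (\<lambda>n. S_neg {a1, a2} n * e1^(2 * n)) *
       Abs_fps (\<lambda>n. S_neg {a1, a2} n * e2^(2 * n)))"
  by (rule S_product_generating_function) (simp_all add: indet_eq_iff)

end
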